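(* Assume the following hypothesis (H): for all values of $t>0$ and all integers $P\ge 1$, all zeros of $Q_P$ lie strictly below the real axis, i.e. $Q_P(z_j)=0$ implies $\operatorname{Im}(z_j)<0$. Then, for all such $t$ and $P$, the Padé approximant $R_P=T_P/Q_P$ satisfies $|R_P(z)|\le 1$ for all $z\in\mathbb{C}$ with $\operatorname{Im}(z)\ge 0$, and among these $z$ the equality $|R_P(z)|=1$ holds if and only if $z\in\mathbb{R}$.
   Context: For a real parameter $t>0$ let $f(z)=\mathrm{e}^{\mathrm{i}t(\sqrt{1+z}-1)}$, with the principal branch of the square root, holomorphic on $\Omega=\mathbb{C}\setminus(-\infty,-1]$, and let $f(z)=\sum_{k\ge 0}c_kz^k$ be its Taylor series at $z=0$. For an integer $P\ge 1$, the $[P/P]$-Padé approximant of $f$ at $0$ is $R_P(z)=T_P(z)/Q_P(z)$, where $T_P,Q_P$ are complex polynomials with $\deg T_P=\deg Q_P=P$ and $Q_P(z)f(z)-T_P(z)=O(z^{2P+1})$ as $z\to0$, normalized by $Q_P(0)=1$. The pair $(T_P,Q_P)$ depends on $t$ and $P$. It is considered for those $(t,P)$ for which $\det(c_{P+i-j})_{i,j=1}^P\neq 0$, which ensures that the pair solving the Padé condition is unique up to a common scalar factor (hence unique after normalization). Both the hypothesis (H) and the conclusion range over these $(t,P)$. *)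

theory Defs
  imports "HOL-Analysis.Analysis" "HOL-Library.Landau_Symbols"
    "HOL-Computational_Algebra.Polynomial" "Jordan_Normal_Form.Determinant"
begin

definition prop_symbol :: "real \<Rightarrow> complex \<Rightarrow> complex" where
  "prop_symbol t z = exp (\<i> * of_real t * (csqrt (1 + z) - 1))"

definition taylor_coeff :: "(complex \<Rightarrow> complex) \<Rightarrow> nat \<Rightarrow> complex" where
  "taylor_coeff f k = (deriv ^^ k) f 0 / fact k"

(* Shifting both row and column index from {1..P} to {0..<P} leaves i - j unchanged, and
   P + i - j does not truncate because j < P. Qualified names: the session HOL-Analysis has
   its own mat and det, for type-indexed matrices. *)
definition pade_matrix :: "(complex \<Rightarrow> complex) \<Rightarrow> nat \<Rightarrow> complex Matrix.mat" where
  "pade_matrix f P = Matrix.mat P P (\<lambda>(i, j). taylor_coeff f (P + i - j))"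

definition pade_regular :: "(complex \<Rightarrow> complex) \<Rightarrow> nat \<Rightarrow> bool" where
  "pade_regular f P \<longleftrightarrow> Determinant.det (pade_matrix f P) \<noteq> 0"

(* Numerator T and denominator Q of the [P/P] approximant of f at 0, both of exact degree P.
   If pade_regular f P, at most one pair (T, Q) satisfies this. *)
definition is_pade_pair ::
    "(complex \<Rightarrow> complex) \<Rightarrow> nat \<Rightarrow> complex poly \<Rightarrow> complex poly \<Rightarrow> bool" where
  "is_pade_pair f P T Q \<longleftrightarrow>
     degree T = P \<and> degree Q = P \<and> poly Q 0 = 1 \<and>
     (\<lambda>z. poly Q z * f z - poly T z) \<in> O[at 0](\<lambda>z. z ^ (2 * P + 1))"

definition pade_approximant :: "complex poly \<Rightarrow> complex poly \<Rightarrow> complex \<Rightarrow> complex" where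
  "pade_approximant T Q z = poly T z / poly Q z"

end

theory Submission
  imports
    Defs
    "HOL-Computational_Algebra.Fundamental_Theorem_Algebra"
    "HOL-Computational_Algebra.Field_as_Ring"
begin

text \<open>
  For a function \<open>f\<close> write \<open>f\<^sup>*(z)\<close> for the conjugate of \<open>f\<close> at the conjugate of \<open>z\<close>; for a
  polynomial this conjugates the coefficients. The symbol is unimodular on the real line near \<open>0\<close>,
  which in terms of analytic functions says \<open>f\<^sup>* f = 1\<close> near \<open>0\<close>. Applying the operation to
  \<open>Q f - T = O(z\<^sup>2\<^sup>P\<^sup>+\<^sup>1)\<close> and multiplying by \<open>-f\<close> gives \<open>T\<^sup>* f - Q\<^sup>* = O(z\<^sup>2\<^sup>P\<^sup>+\<^sup>1)\<close>: so
  \<open>(Q\<^sup>*, T\<^sup>*)\<close> is a Pade pair as well (\<open>is_pade_pair_conj_swap\<close>), and eliminating \<open>f\<close> between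
  the two pairs yields the polynomial identity \<open>T T\<^sup>* = Q\<^sup>* Q\<close> (\<open>pade_cross_product\<close>).

  The hypothesis on zeros applies to both pairs. For the given one it puts the zeros of \<open>Q\<close> in the
  open lower half-plane; for the reflected one it puts the zeros of \<open>T\<^sup>*\<close> there, that is, those of
  \<open>T\<close> in the open upper half-plane. Hence \<open>T\<close> and \<open>Q\<close> are coprime, \<open>T\<close> divides \<open>Q\<^sup>*\<close>, and
  comparing degrees and values at \<open>0\<close> gives \<open>T = Q\<^sup>*\<close>
  (\<open>pade_numerator_eq_cnj_denominator\<close>).

  Consequently the modulus of the approximant at \<open>z\<close> is the quotient of the moduli of \<open>Q\<close> at the
  conjugate of \<open>z\<close> and at \<open>z\<close>. It equals \<open>1\<close> for real \<open>z\<close>. Above the real axis it is a product of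
  \<open>P \<ge> 1\<close> factors less than \<open>1\<close>, because each zero of \<open>Q\<close> lies in the lower half-plane and is
  therefore closer to the conjugate of \<open>z\<close> than to \<open>z\<close> (\<open>norm_poly_cnj_less\<close>).
\<close>

section \<open>Vanishing orders at the origin\<close>

lemma degree_map_poly_cnj [simp]: "degree (map_poly cnj p) = degree p"
  by (rule degree_map_poly) auto

lemma tendsto_0_if_bigo_power:
  fixes g :: "complex \<Rightarrow> complex"
  assumes "g \<in> O[at 0](\<lambda>z. z ^ n)" "n > 0"
  shows "(g \<longlongrightarrow> 0) (at 0)"
proof -
  have "((\<lambda>z::complex. z ^ n) \<longlongrightarrow> 0 ^ n) (at 0)"
    by (intro tendsto_intros)
  then have "(\<lambda>z::complex. z ^ n) \<in> o[at 0](\<lambda>_. 1)"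
    using assms(2) by (intro smalloI_tendsto) (auto simp: power_0_left)
  with assms(1) have "g \<in> o[at 0](\<lambda>_. 1)"
    by (rule landau_o.big_small_trans)
  then show ?thesis
    using smalloD_tendsto by fastforce
qed

text \<open>
  Splitting off the exact power of \<open>z\<close> that divides a nonzero polynomial leaves a factor that does
  not vanish at \<open>0\<close>. The exponent is at most the degree, so a higher vanishing order would force
  that factor to tend to \<open>0\<close>.
\<close>
lemma poly_eq_0_if_bigo_power:
  fixes p :: "complex poly"
  assumes "poly p \<in> O[at 0](\<lambda>z. z ^ n)" "degree p < n"
  shows "p = 0"
proof (rule ccontr)
  assume "p \<noteq> 0"
  define m where "m = order 0 p"
  obtain q where q: "p = [:- 0, 1:] ^ m * q" "\<not> [:- 0, 1:] dvd q"
    using order_decomp[OF \<open>p \<noteq> 0\<close>, of 0] unfolding m_def by blast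
  have mn: "m < n"
    using order_degree[OF \<open>p \<noteq> 0\<close>, of 0] assms(2) unfolding m_def by linarith
  have pq: "poly p = (\<lambda>z. z ^ m * poly q z)"
    by (rule ext) (simp add: q(1))
  have "(\<lambda>z. z ^ m * poly q z) \<in> O[at 0](\<lambda>z. z ^ m * z ^ (n - m))"
    using assms(1) mn unfolding pq by (simp flip: power_add)
  moreover have "eventually (\<lambda>z::complex. z ^ m \<noteq> 0) (at 0)"
    unfolding eventually_at_filter by (rule always_eventually) simp
  ultimately have "poly q \<in> O[at 0](\<lambda>z. z ^ (n - m))"
    by (subst (asm) landau_o.big.mult_cancel_left) auto
  then have "(poly q \<longlongrightarrow> 0) (at 0)"
    by (rule tendsto_0_if_bigo_power) (use mn in simp)
  moreover have "(poly q \<longlongrightarrow> poly q 0) (at 0)"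
    by (intro tendsto_intros)
  ultimately have "poly q 0 = 0"
    using LIM_unique by blast
  then show False
    using q(2) by (simp add: poly_eq_0_iff_dvd)
qed

lemma bigo_power_cnj:
  fixes g :: "complex \<Rightarrow> complex"
  assumes "g \<in> O[at 0](\<lambda>z. z ^ n)"
  shows "(\<lambda>z. cnj (g (cnj z))) \<in> O[at 0](\<lambda>z. z ^ n)"
proof -
  have lim: "filterlim cnj (at 0) (at 0)"
    by (intro filterlim_atI tendsto_eq_intros) (auto simp: eventually_at_filter)
  have "(\<lambda>z. g (cnj z)) \<in> O[at 0](\<lambda>z. cnj z ^ n)"
    by (rule landau_o.big.compose[OF assms lim])
  then show ?thesis
    by (simp add: bigo_def norm_power)
qed

section \<open>Reflection of Pade pairs in the real axis\<close>

text \<open>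
  On the unit disc \<open>1 + z\<close> avoids the branch cut, so the square root commutes with conjugation and
  reflection only changes the sign of the exponent.
\<close>
lemma cnj_prop_symbol_cnj:
  assumes "norm z < 1"
  shows "cnj (prop_symbol t (cnj z)) * prop_symbol t z = 1"
proof -
  have "Re z > -1"
    using assms abs_Re_le_cmod[of z] by linarith
  then have "csqrt (cnj (1 + z)) = cnj (csqrt (1 + z))"
    by (subst cnj_csqrt) (auto simp: complex_nonpos_Reals_iff)
  then show ?thesis
    by (simp add: prop_symbol_def exp_cnj flip: exp_add)
qed

lemma isCont_prop_symbol: "isCont (prop_symbol t) 0"
  unfolding prop_symbol_def by (intro continuous_intros) auto

lemma pade_numerator_at_0:
  assumes f: "isCont f 0" "f 0 = 1" and pade: "is_pade_pair f P T Q"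
  shows "poly T 0 = 1"
proof -
  have "((\<lambda>z. poly Q z * f z - poly T z) \<longlongrightarrow> 0) (at 0)"
    using pade unfolding is_pade_pair_def by (intro tendsto_0_if_bigo_power) auto
  moreover have "((\<lambda>z. poly Q z * f z - poly T z) \<longlongrightarrow> poly Q 0 * f 0 - poly T 0) (at 0)"
    using f(1) by (intro tendsto_intros) (auto simp: isCont_def)
  ultimately have "poly Q 0 * f 0 - poly T 0 = 0"
    using LIM_unique by blast
  then show ?thesis
    using f(2) pade by (simp add: is_pade_pair_def)
qed

text \<open>
  Since \<open>f\<close> is bounded near \<open>0\<close>, multiplying the reflected Pade condition by \<open>-f\<close> keeps its order;
  \<open>f\<^sup>* f = 1\<close> then exchanges the roles of numerator and denominator. The value \<open>f 0 = 1\<close> makes the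
  new denominator, the reflection of \<open>T\<close>, normalized.
\<close>
lemma is_pade_pair_conj_swap:
  assumes cont: "isCont f 0" and f0: "f 0 = 1"
    and unimod: "eventually (\<lambda>z. cnj (f (cnj z)) * f z = 1) (at 0)"
    and pade: "is_pade_pair f P T Q"
  shows "is_pade_pair f P (map_poly cnj Q) (map_poly cnj T)"
proof -
  have "(\<lambda>z. cnj (poly Q (cnj z) * f (cnj z) - poly T (cnj z))) \<in> O[at 0](\<lambda>z. z ^ (2 * P + 1))"
    using pade unfolding is_pade_pair_def by (intro bigo_power_cnj) auto
  moreover have "(\<lambda>z. - f z) \<in> O[at 0](\<lambda>_. 1)"
    using cont by (intro bigoI_tendsto[where c = "- f 0"]) (auto simp: isCont_def intro!: tendsto_intros)
  ultimately have "(\<lambda>z. - f z * cnj (poly Q (cnj z) * f (cnj z) - poly T (cnj z)))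
      \<in> O[at 0](\<lambda>z. 1 * z ^ (2 * P + 1))"
    by (intro landau_o.big.mult)
  also have "?this \<longleftrightarrow> (\<lambda>z. poly (map_poly cnj T) z * f z - poly (map_poly cnj Q) z)
      \<in> O[at 0](\<lambda>z. 1 * z ^ (2 * P + 1))"
  proof (rule landau_o.big.in_cong)
    show "\<forall>\<^sub>F z in at 0. - f z * cnj (poly Q (cnj z) * f (cnj z) - poly T (cnj z)) =
        poly (map_poly cnj T) z * f z - poly (map_poly cnj Q) z"
      using unimod
    proof eventually_elim
      case (elim z)
      have "- f z * cnj (poly Q (cnj z) * f (cnj z) - poly T (cnj z)) =
          cnj (poly T (cnj z)) * f z - cnj (poly Q (cnj z)) * (cnj (f (cnj z)) * f z)"
        by (simp add: algebra_simps)
      then show ?case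
        by (simp add: elim)
    qed
  qed
  finally show ?thesis
    using pade pade_numerator_at_0[OF cont f0 pade]
    by (simp add: is_pade_pair_def)
qed

text \<open>
  Two Pade pairs represent the same rational function: eliminating \<open>f\<close> leaves a polynomial of
  degree at most \<open>2P\<close> that vanishes to order \<open>2P + 1\<close>.
\<close>
lemma pade_cross_product:
  assumes T1: "is_pade_pair f P T1 Q1" and T2: "is_pade_pair f P T2 Q2"
  shows "T1 * Q2 = T2 * Q1"
proof -
  have bounded: "poly q \<in> O[at 0](\<lambda>_. 1)" for q :: "complex poly"
    by (rule bigoI_tendsto[where c = "poly q 0"]) (auto intro!: tendsto_intros)
  have "(\<lambda>z. poly Q1 z * (poly Q2 z * f z - poly T2 z)) \<in> O[at 0](\<lambda>z. 1 * z ^ (2 * P + 1))"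
    using T2 unfolding is_pade_pair_def by (intro landau_o.big.mult bounded) blast
  moreover have "(\<lambda>z. poly Q2 z * (poly Q1 z * f z - poly T1 z)) \<in> O[at 0](\<lambda>z. 1 * z ^ (2 * P + 1))"
    using T1 unfolding is_pade_pair_def by (intro landau_o.big.mult bounded) blast
  ultimately have "(\<lambda>z. poly Q1 z * (poly Q2 z * f z - poly T2 z) -
      poly Q2 z * (poly Q1 z * f z - poly T1 z)) \<in> O[at 0](\<lambda>z. 1 * z ^ (2 * P + 1))"
    by (rule sum_in_bigo)
  also have "(\<lambda>z. poly Q1 z * (poly Q2 z * f z - poly T2 z) -
      poly Q2 z * (poly Q1 z * f z - poly T1 z)) = poly (T1 * Q2 - T2 * Q1)"
    by (rule ext) (simp add: algebra_simps)
  finally have "poly (T1 * Q2 - T2 * Q1) \<in> O[at 0](\<lambda>z. z ^ (2 * P + 1))"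
    by (simp only: mult_1)
  moreover have "degree (T1 * Q2 - T2 * Q1) < 2 * P + 1"
    using T1 T2 degree_mult_le[of T1 Q2] degree_mult_le[of T2 Q1]
    by (intro le_less_trans[OF degree_diff_le[of _ "2 * P"]]) (auto simp: is_pade_pair_def)
  ultimately show ?thesis
    using poly_eq_0_if_bigo_power by fastforce
qed

section \<open>Consequences of the location of the zeros\<close>

lemma coprime_poly_if_no_common_root:
  fixes p q :: "complex poly"
  assumes "p \<noteq> 0" "\<And>z. poly p z = 0 \<Longrightarrow> poly q z \<noteq> 0"
  shows "coprime p q"
proof (rule coprimeI)
  fix d assume d: "d dvd p" "d dvd q"
  have "degree d = 0"
  proof (rule ccontr)
    assume "degree d \<noteq> 0"
    then obtain z where "poly d z = 0"
      by (metis constant_degree fundamental_theorem_of_algebra)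
    with d show False
      using assms(2) by (metis dvd_trans poly_eq_0_iff_dvd)
  qed
  with d(1) \<open>p \<noteq> 0\<close> show "is_unit d"
    by (auto simp: is_unit_iff_degree)
qed

text \<open>
  The inequality holds for each linear factor, since a point of the open lower half-plane is closer
  to \<open>cnj z\<close> than to \<open>z\<close>; the induction multiplies these inequalities.
\<close>
lemma norm_poly_cnj_less:
  assumes "degree p > 0" "\<And>w. poly p w = 0 \<Longrightarrow> Im w < 0" "Im z > 0"
  shows "norm (poly p (cnj z)) < norm (poly p z)"
  using assms(1,2)
proof (induction "degree p" arbitrary: p)
  case 0
  then show ?case by simp
next
  case (Suc n)
  obtain a where a: "poly p a = 0"
    using Suc.prems(1) by (metis constant_degree fundamental_theorem_of_algebra less_irrefl)
  then obtain q where q: "p = [:-a, 1:] * q"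
    by (metis dvdE poly_eq_0_iff_dvd)
  have "q \<noteq> 0"
    using q Suc.prems(1) by auto
  then have n: "n = degree q"
    using Suc.hyps(2) unfolding q by (subst (asm) degree_mult_eq) auto
  have roots: "poly q w = 0 \<Longrightarrow> Im w < 0" for w
    using Suc.prems(2)[of w] by (simp add: q)
  \<comment> \<open>Only the weak inequality survives for \<open>q\<close>, which may be constant; strictness comes from
      the factor split off.\<close>
  have "norm (poly q (cnj z)) \<le> norm (poly q z)"
  proof (cases "n = 0")
    case True
    then obtain c where "q = [:c:]"
      using n degree_eq_zeroE by metis
    then show ?thesis by simp
  next
    case False
    then show ?thesis
      using Suc.hyps(1)[OF n] n roots by (simp add: less_imp_le)
  qed
  moreover have "norm (poly q z) > 0"
    using roots[of z] assms(3) by fastforce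
  moreover have "norm (cnj z - a) < norm (z - a)"
  proof -
    have "(Im z + Im a)\<^sup>2 < (Im z - Im a)\<^sup>2"
      using assms(3) Suc.prems(2)[OF a] mult_pos_neg[of "Im z" "Im a"]
      by (simp add: power2_eq_square algebra_simps)
    then have "(- Im z - Im a)\<^sup>2 < (Im z - Im a)\<^sup>2"
      by (simp add: power2_eq_square algebra_simps)
    then show ?thesis
      by (simp add: cmod_def)
  qed
  ultimately have "norm (cnj z - a) * norm (poly q (cnj z)) < norm (z - a) * norm (poly q z)"
    by (intro le_less_trans[OF mult_left_mono mult_strict_right_mono]) auto
  then show ?case
    by (simp add: q left_diff_distrib flip: norm_mult)
qed

text \<open>
  The assumption on zeros has to cover all pairs for \<open>f\<close> and \<open>P\<close>, because it is used for the
  reflected pair as well: there it says where the zeros of the numerator \<open>T\<close> are. This rules out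
  cancellation in \<open>T T\<^sup>* = Q\<^sup>* Q\<close>.
\<close>
lemma pade_numerator_eq_cnj_denominator:
  assumes cont: "isCont f 0" and f0: "f 0 = 1"
    and unimod: "eventually (\<lambda>z. cnj (f (cnj z)) * f z = 1) (at 0)"
    and lower: "\<And>T Q z. is_pade_pair f P T Q \<Longrightarrow> poly Q z = 0 \<Longrightarrow> Im z < 0"
    and pade: "is_pade_pair f P T Q"
  shows "T = map_poly cnj Q"
proof -
  have swap: "is_pade_pair f P (map_poly cnj Q) (map_poly cnj T)"
    using cont f0 unimod pade by (rule is_pade_pair_conj_swap)
  have T0: "poly T 0 = 1"
    using cont f0 pade by (rule pade_numerator_at_0)
  have upper: "Im z > 0" if "poly T z = 0" for z
    using lower[OF swap, of "cnj z"] that by simp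
  have "T \<noteq> 0"
    using T0 by auto
  moreover have "poly Q z \<noteq> 0" if "poly T z = 0" for z
    using upper[OF that] lower[OF pade, of z] by auto
  ultimately have "coprime T Q"
    by (rule coprime_poly_if_no_common_root)
  moreover have "T dvd map_poly cnj Q * Q"
    using pade_cross_product[OF pade swap] by (metis dvd_triv_left)
  ultimately have "T dvd map_poly cnj Q"
    by (simp add: coprime_dvd_mult_left_iff)
  then obtain s where s: "map_poly cnj Q = T * s"
    by (elim dvdE)
  have Q0: "poly (map_poly cnj Q) 0 = 1"
    using pade by (simp add: is_pade_pair_def)
  have "s \<noteq> 0"
    using s Q0 by auto
  then have "degree s = 0"
    using arg_cong[OF s, of degree] pade \<open>T \<noteq> 0\<close> by (simp add: degree_mult_eq is_pade_pair_def)
  then obtain c where "s = [:c:]"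
    using degree_eq_zeroE by metis
  with Q0 T0 s show ?thesis
    by simp
qed

theorem proposition3p3:
  assumes H: "\<And>(t::real) (P::nat) (T::complex poly) (Q::complex poly) (z::complex).
      t > 0 \<Longrightarrow> P \<ge> 1 \<Longrightarrow> pade_regular (prop_symbol t) P \<Longrightarrow>
      is_pade_pair (prop_symbol t) P T Q \<Longrightarrow> poly Q z = 0 \<Longrightarrow> Im z < 0"
  shows "\<forall>(t::real) (P::nat) (T::complex poly) (Q::complex poly).
      t > 0 \<longrightarrow> P \<ge> 1 \<longrightarrow> pade_regular (prop_symbol t) P \<longrightarrow>
      is_pade_pair (prop_symbol t) P T Q \<longrightarrow>
      (\<forall>z. Im z \<ge> 0 \<longrightarrow>
         norm (pade_approximant T Q z) \<le> 1 \<and>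
         (norm (pade_approximant T Q z) = 1 \<longleftrightarrow> z \<in> \<real>))"
proof (intro allI impI)
  fix t :: real and P :: nat and T Q :: "complex poly" and z :: complex
  assume asm: "t > 0" "P \<ge> 1" "pade_regular (prop_symbol t) P"
    and pade: "is_pade_pair (prop_symbol t) P T Q" and z: "Im z \<ge> 0"
  have lower: "Im w < 0" if "is_pade_pair (prop_symbol t) P T' Q'" "poly Q' w = 0" for T' Q' w
    using H[OF asm that] .
  have "eventually (\<lambda>z. z \<in> ball 0 1) (at (0::complex))"
    by (intro eventually_at_in_open') auto
  then have "eventually (\<lambda>z. cnj (prop_symbol t (cnj z)) * prop_symbol t z = 1) (at 0)"
    by eventually_elim (simp add: cnj_prop_symbol_cnj)
  then have T: "T = map_poly cnj Q"
    using isCont_prop_symbol[of t] lower pade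
    by (intro pade_numerator_eq_cnj_denominator[of "prop_symbol t" P])
       (auto simp: prop_symbol_def[of t 0])
  have R: "norm (pade_approximant T Q z) = norm (poly Q (cnj z)) / norm (poly Q z)"
    by (simp add: pade_approximant_def T norm_divide)
  have Qz: "norm (poly Q z) > 0"
    using lower[OF pade, of z] z by fastforce
  show "norm (pade_approximant T Q z) \<le> 1 \<and> (norm (pade_approximant T Q z) = 1 \<longleftrightarrow> z \<in> \<real>)"
  proof (cases "Im z = 0")
    case True
    then have "z \<in> \<real>"
      by (simp add: complex_is_Real_iff)
    with Qz show ?thesis
      by (simp add: R Reals_cnj_iff)
  next
    case False
    have "norm (poly Q (cnj z)) < norm (poly Q z)"
      using asm(2) pade lower[OF pade] z False
      by (intro norm_poly_cnj_less) (auto simp: is_pade_pair_def)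
    with Qz False show ?thesis
      by (simp add: R complex_is_Real_iff)
  qed
qed

end
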